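(* Every simplicial tree $\Delta$ is collapsible, and therefore contractible and acyclic.
   Context: A simplicial complex $\Delta$ on a nonempty finite vertex set $V=\{v_1,\ldots,v_n\}$ is a collection of subsets of $V$ (faces), closed under taking subsets, with $\{v_i\}\in\Delta$ for all $i$. Facets are the faces maximal under inclusion. A subcollection of $\Delta$ is a simplicial complex generated by a subset of the set of facets of $\Delta$. A facet $F$ of a simplicial complex is a leaf if either it is the only facet, or there is a facet $G\neq F$ such that $F\cap H\subseteq G$ for every facet $H\neq F$. A simplicial tree is a connected simplicial complex such that every nonempty subcollection (i.e. generated by a nonempty set of facets) has a leaf. Elementary collapse: let $F$ be a facet of $\Delta$ and let $F'\neq\emptyset$ be a maximal proper face of $F$ (so $|F'|=|F|-1$) that is contained in no facet of $\Delta$ other than $F$. Then the simplicial complex $\Delta\setminus\{F,F'\}$ is said to be obtained from $\Delta$ by an elementary collapse. $\Delta$ is collapsible if a (possibly empty) sequence of elementary collapses reduces it to a single point. Contractible means that the geometric realization is contractible; acyclic means that the reduced simplicial homology (with coefficients in any field) vanishes in all degrees. *)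

theory Defs
  imports "HOL-Analysis.Analysis" "HOL-Algebra.Elementary_Groups"
begin

definition complex_on :: "'a set \<Rightarrow> 'a set set \<Rightarrow> bool" where
  "complex_on V \<Delta> \<longleftrightarrow>
     finite V \<and> V \<noteq> {} \<and> \<Delta> \<subseteq> Pow V \<and>
     (\<forall>F\<in>\<Delta>. \<forall>G. G \<subseteq> F \<longrightarrow> G \<in> \<Delta>) \<and> (\<forall>v\<in>V. {v} \<in> \<Delta>)"

definition facets :: "'a set set \<Rightarrow> 'a set set" where
  "facets \<Delta> = {F \<in> \<Delta>. \<forall>G\<in>\<Delta>. F \<subseteq> G \<longrightarrow> G = F}"

definition generated_complex :: "'a set set \<Rightarrow> 'a set set" where
  "generated_complex S = {G. \<exists>F\<in>S. G \<subseteq> F}"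

definition is_leaf :: "'a set set \<Rightarrow> 'a set \<Rightarrow> bool" where
  "is_leaf \<Delta> F \<longleftrightarrow>
     F \<in> facets \<Delta> \<and>
     (facets \<Delta> = {F} \<or>
      (\<exists>G\<in>facets \<Delta>. G \<noteq> F \<and> (\<forall>H\<in>facets \<Delta>. H \<noteq> F \<longrightarrow> F \<inter> H \<subseteq> G)))"

text \<open>Any two facets are joined by a chain of facets in which consecutive facets meet.\<close>

definition connected_complex :: "'a set set \<Rightarrow> bool" where
  "connected_complex \<Delta> \<longleftrightarrow>
     (\<forall>F\<in>facets \<Delta>. \<forall>G\<in>facets \<Delta>.
        (F, G) \<in> {(A, B). A \<in> facets \<Delta> \<and> B \<in> facets \<Delta> \<and> A \<inter> B \<noteq> {}}\<^sup>*)"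

definition simplicial_tree :: "'a set \<Rightarrow> 'a set set \<Rightarrow> bool" where
  "simplicial_tree V \<Delta> \<longleftrightarrow>
     complex_on V \<Delta> \<and> connected_complex \<Delta> \<and>
     (\<forall>S. S \<subseteq> facets \<Delta> \<and> S \<noteq> {} \<longrightarrow> (\<exists>F. is_leaf (generated_complex S) F))"

definition elementary_collapse :: "'a set set \<Rightarrow> 'a set set \<Rightarrow> bool" where
  "elementary_collapse \<Delta> \<Delta>' \<longleftrightarrow>
     (\<exists>F F'. F \<in> facets \<Delta> \<and> F' \<noteq> {} \<and> F' \<subseteq> F \<and> card F = card F' + 1 \<and>
        (\<forall>H\<in>facets \<Delta>. F' \<subseteq> H \<longrightarrow> H = F) \<and> \<Delta>' = \<Delta> - {F, F'})"

text \<open>Complexes contain the empty face, so a single point is the complex \<open>{{}, {v}}\<close>.\<close>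

definition collapsible :: "'a set set \<Rightarrow> bool" where
  "collapsible \<Delta> \<longleftrightarrow> (\<exists>v. elementary_collapse\<^sup>*\<^sup>* \<Delta> {{}, {v}})"

text \<open>
  Barycentric coordinates, following the library's \<open>standard_simplex\<close>: coordinates of
  non-vertices vanish because the support of a point is a face.  As \<open>\<Delta>\<close> is finite, the
  subspace topology agrees with the weak topology.
\<close>

definition geometric_realization :: "'a set set \<Rightarrow> ('a \<Rightarrow> real) topology" where
  "geometric_realization \<Delta> =
     subtopology (powertop_real UNIV)
       {x. (\<forall>v. 0 \<le> x v) \<and> {v. x v \<noteq> 0} \<in> \<Delta> \<and> (\<Sum>v\<in>\<Union>\<Delta>. x v) = 1}"

text \<open>
  Reduced simplicial chains of a finite complex, with the vertices ordered by a linear order \<open>r\<close>.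
  A \<open>p\<close>-chain is the function giving the coefficient of each face; the \<open>p\<close>-faces have \<open>p + 1\<close>
  vertices, and the empty face spans the augmentation in degree \<open>-1\<close>.
\<close>

definition simp_chains :: "'a set set \<Rightarrow> int \<Rightarrow> ('a set \<Rightarrow> 'k::field) set" where
  "simp_chains \<Delta> p = {c. \<forall>F. c F \<noteq> 0 \<longrightarrow> F \<in> \<Delta> \<and> int (card F) = p + 1}"

text \<open>
  The linear extension of \<open>\<partial>[v\<^sub>0,\<dots>,v\<^sub>p] = (\<Sum>i\<le>p. (-1)^i [v\<^sub>0,\<dots>,v\<^sub>p without v\<^sub>i])\<close>, where
  \<open>v\<^sub>0 < \<dots> < v\<^sub>p\<close>: the exponent of the sign counts the vertices of the face before \<open>v\<close>.
\<close>

definition simp_boundary ::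
  "('a \<times> 'a) set \<Rightarrow> 'a set set \<Rightarrow> ('a set \<Rightarrow> 'k::field) \<Rightarrow> 'a set \<Rightarrow> 'k" where
  "simp_boundary r \<Delta> c =
     (\<lambda>G. \<Sum>F\<in>\<Delta>. \<Sum>v\<in>F.
        if G = F - {v} then (-1) ^ card {u \<in> F. u \<noteq> v \<and> (u, v) \<in> r} * c F else 0)"

definition simp_cycle_group ::
  "('a \<times> 'a) set \<Rightarrow> 'a set set \<Rightarrow> int \<Rightarrow> ('a set \<Rightarrow> 'k::field) monoid" where
  "simp_cycle_group r \<Delta> p =
     \<lparr>carrier = {c \<in> simp_chains \<Delta> p. simp_boundary r \<Delta> c = (\<lambda>_. 0)},
      mult = (\<lambda>a b F. a F + b F), one = (\<lambda>_. 0)\<rparr>"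

text \<open>
  The additive group of the vector space of cycles modulo boundaries; the vector space is zero iff
  this group is trivial.
\<close>

definition reduced_simp_homology ::
  "('a \<times> 'a) set \<Rightarrow> 'a set set \<Rightarrow> int \<Rightarrow> ('a set \<Rightarrow> 'k::field) set monoid" where
  "reduced_simp_homology r \<Delta> p =
     simp_cycle_group r \<Delta> p Mod (simp_boundary r \<Delta> ` simp_chains \<Delta> (p + 1))"

text \<open>
  Up to isomorphism the homology does not depend on the auxiliary vertex order, so no particular
  one is chosen.
\<close>

definition acyclic_complex :: "'k::field itself \<Rightarrow> 'a set set \<Rightarrow> bool" where
  "acyclic_complex _ \<Delta> \<longleftrightarrow>
     (\<forall>r p. linear_order_on (\<Union>\<Delta>) r \<longrightarrow>
        trivial_group (reduced_simp_homology r \<Delta> p :: ('a set \<Rightarrow> 'k) set monoid))"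

end

theory Submission imports Defs begin

text \<open>
  If \<open>F\<close> is a leaf with joint \<open>G\<close>, the vertices of \<open>F - G\<close> lie in no other facet, so they are all
  dominated by any vertex of \<open>F \<inter> G\<close>, and deleting them leaves the complex generated by the other
  facets, which is again a tree.  Hence a tree is reduced to a point by deletions of dominated
  vertices.  Such a deletion of \<open>v\<close>, dominated by \<open>a\<close>, is a sequence of elementary collapses of the
  pairs \<open>B\<close>, \<open>B \<union> {a}\<close> with \<open>v \<in> B\<close>; it is a homotopy equivalence, moving the
  weight of \<open>v\<close> linearly to \<open>a\<close>; and every cycle is homologous to one avoiding \<open>v\<close>.
\<close>

section \<open>Deleting dominated vertices\<close>

text \<open>Unlike \<open>complex_on\<close>, this carries no separate vertex set, so the notion
  passes to deletions directly.\<close>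

definition finite_complex :: "'a set set \<Rightarrow> bool" where
  "finite_complex \<Delta> \<longleftrightarrow> finite (\<Union>\<Delta>) \<and> (\<forall>F\<in>\<Delta>. \<forall>G. G \<subseteq> F \<longrightarrow> G \<in> \<Delta>)"

text \<open>For a vertex \<open>v\<close> of \<Delta> this says that the link of \<open>v\<close> is
  a cone with apex \<open>a\<close>. It allows \<open>v\<close> to lie in no face, and deleting
  \<open>v\<close> then changes nothing.\<close>

definition dominated :: "'a set set \<Rightarrow> 'a \<Rightarrow> 'a \<Rightarrow> bool" where
  "dominated \<Delta> v a \<longleftrightarrow> a \<noteq> v \<and> (\<forall>B\<in>\<Delta>. v \<in> B \<longrightarrow> insert a B \<in> \<Delta>)"

text \<open>This is strong collapsibility in the sense of Barmak and Minian. All three conclusions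
  of the theorem are derived from it by induction.\<close>

inductive strong_collapsible :: "'a set set \<Rightarrow> bool" where
  point: "strong_collapsible {{}, {v}}"
| step: "finite_complex \<Delta> \<Longrightarrow> dominated \<Delta> v a \<Longrightarrow> strong_collapsible {B\<in>\<Delta>. v \<notin> B}
    \<Longrightarrow> strong_collapsible \<Delta>"

lemma finite_complex_finite:
  assumes "finite_complex \<Delta>"
  shows "finite \<Delta>"
  using assms by (simp add: finite_complex_def finite_UnionD)

lemma finite_complex_finite_face:
  assumes "finite_complex \<Delta>" "F \<in> \<Delta>"
  shows "finite F"
  using assms finite_subset[of F "\<Union>\<Delta>"] by (auto simp: finite_complex_def)

lemma finite_complex_down:
  assumes "finite_complex \<Delta>" "F \<in> \<Delta>" "G \<subseteq> F"
  shows "G \<in> \<Delta>"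
  using assms unfolding finite_complex_def by blast

lemma finite_complex_deletion:
  assumes "finite_complex \<Delta>"
  shows "finite_complex {B\<in>\<Delta>. v \<notin> B}"
proof -
  have "\<Union>{B\<in>\<Delta>. v \<notin> B} \<subseteq> \<Union>\<Delta>" by blast
  then show ?thesis
    using assms unfolding finite_complex_def by (auto intro: finite_subset)
qed

lemma strong_collapsible_finite_complex:
  "strong_collapsible \<Delta> \<Longrightarrow> finite_complex \<Delta>"
proof (induction rule: strong_collapsible.induct)
  case (point v)
  show ?case unfolding finite_complex_def by auto
qed assumption

text \<open>The common dominating vertex \<open>a\<close> is outside \<open>W\<close>, so it
  survives every deletion and keeps dominating the vertices of \<open>W\<close> that remain. They
  can therefore be deleted one at a time.\<close>

lemma strong_collapsible_delete_set:
  assumes "finite W" "finite_complex \<Delta>" "\<And>w. w \<in> W \<Longrightarrow> dominated \<Delta> w a"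
    and "strong_collapsible {B\<in>\<Delta>. B \<inter> W = {}}"
  shows "strong_collapsible \<Delta>"
  using assms
proof (induction W arbitrary: \<Delta> rule: finite_induct)
  case empty
  then show ?case by simp
next
  case (insert v W)
  let ?D = "{B\<in>\<Delta>. v \<notin> B}"
  have "strong_collapsible ?D"
  proof (rule insert.IH)
    show "finite_complex ?D" by (rule finite_complex_deletion[OF insert.prems(1)])
    show "dominated ?D w a" if "w \<in> W" for w
      using insert.prems(2)[of w] insert.prems(2)[of v] that by (auto simp: dominated_def)
    have "{B\<in>?D. B \<inter> W = {}} = {B\<in>\<Delta>. B \<inter> insert v W = {}}" by auto
    then show "strong_collapsible {B\<in>?D. B \<inter> W = {}}"
      using insert.prems(3) by argo
  qed
  then show ?case
    by (rule strong_collapsible.step[OF insert.prems(1) insert.prems(2)[OF insertI1]])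
qed

section \<open>Trees\<close>

lemma facets_generated:
  assumes "\<And>F G. F \<in> S \<Longrightarrow> G \<in> S \<Longrightarrow> F \<subseteq> G \<Longrightarrow> F = G"
  shows "facets (generated_complex S) = S"
  using assms unfolding facets_def generated_complex_def by blast

lemma ex_facet:
  assumes "finite_complex \<Delta>" "B \<in> \<Delta>"
  shows "\<exists>F\<in>facets \<Delta>. B \<subseteq> F"
proof -
  obtain F where "F \<in> \<Delta>" "B \<subseteq> F" "\<forall>G\<in>\<Delta>. F \<subseteq> G \<longrightarrow> F = G"
    using finite_has_maximal2[OF finite_complex_finite[OF assms(1)] assms(2)] by metis
  then show ?thesis unfolding facets_def by auto
qed

lemma generated_facets:
  assumes "finite_complex \<Delta>"
  shows "generated_complex (facets \<Delta>) = \<Delta>"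
proof (intro equalityI subsetI)
  fix B assume "B \<in> generated_complex (facets \<Delta>)"
  then show "B \<in> \<Delta>"
    using finite_complex_down[OF assms] unfolding generated_complex_def facets_def by auto
next
  fix B assume "B \<in> \<Delta>"
  then show "B \<in> generated_complex (facets \<Delta>)"
    using ex_facet[OF assms] unfolding generated_complex_def by auto
qed

lemma finite_complex_generated:
  assumes "finite S" "\<And>F. F \<in> S \<Longrightarrow> finite F"
  shows "finite_complex (generated_complex S)"
proof -
  have "\<Union>(generated_complex S) = \<Union>S" unfolding generated_complex_def by blast
  then have "finite (\<Union>(generated_complex S))" using assms by auto
  then show ?thesis unfolding finite_complex_def generated_complex_def by blast
qed

abbreviation meets :: "'a set set \<Rightarrow> ('a set \<times> 'a set) set" where
  "meets S \<equiv> {(A, B). A \<in> S \<and> B \<in> S \<and> A \<inter> B \<noteq> {}}"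

text \<open>Every visit of the chain to the leaf \<open>F\<close> is replaced by a visit to its
  joint \<open>G\<close>. A facet other than \<open>F\<close> that meets \<open>F\<close> does so
  inside \<open>G\<close>, hence meets \<open>G\<close> as well. The conditional in the conclusion
  lets the induction pass through \<open>F\<close>.\<close>

lemma connected_remove_leaf:
  assumes "(A, B) \<in> (meets S)\<^sup>*" "A \<in> S - {F}"
    and "G \<in> S" "G \<noteq> F" "\<And>H. H \<in> S \<Longrightarrow> H \<noteq> F \<Longrightarrow> F \<inter> H \<subseteq> G"
  shows "(A, if B = F then G else B) \<in> (meets (S - {F}))\<^sup>*"
  using assms(1)
proof (induction rule: rtrancl_induct)
  case base
  then show ?case using assms(2) by auto
next
  case (step B C)
  let ?j = "\<lambda>B. if B = F then G else B"
  have "B \<in> S" "C \<in> S" "B \<inter> C \<noteq> {}" using step.hyps by auto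
  then have "?j B = ?j C \<or> (?j B, ?j C) \<in> meets (S - {F})"
    using assms(3,4) assms(5)[of B] assms(5)[of C] by auto
  then show ?case
  proof
    assume "?j B = ?j C"
    with step.IH show ?thesis by (rule subst[rotated])
  next
    assume "(?j B, ?j C) \<in> meets (S - {F})"
    with step.IH show ?thesis by (rule rtrancl_into_rtrancl)
  qed
qed

text \<open>The induction runs over the set \<open>S\<close> of facets, because all hypotheses
  except connectedness are inherited by nonempty subsets of \<open>S\<close>.\<close>

lemma tree_strong_collapsible:
  assumes "finite S" "S \<noteq> {}"
    and "\<And>F. F \<in> S \<Longrightarrow> finite F" "\<And>F. F \<in> S \<Longrightarrow> F \<noteq> {}"
    and "\<And>F G. F \<in> S \<Longrightarrow> G \<in> S \<Longrightarrow> F \<subseteq> G \<Longrightarrow> F = G"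
    and "\<And>T. T \<subseteq> S \<Longrightarrow> T \<noteq> {} \<Longrightarrow> \<exists>F. is_leaf (generated_complex T) F"
    and "\<And>F G. F \<in> S \<Longrightarrow> G \<in> S \<Longrightarrow> (F, G) \<in> (meets S)\<^sup>*"
  shows "strong_collapsible (generated_complex S)"
  using assms
proof (induction "card S" arbitrary: S rule: less_induct)
  case less
  let ?D = "generated_complex S"
  have fc: "finite_complex ?D" using finite_complex_generated less.prems by blast
  have fac: "facets ?D = S" by (rule facets_generated) (rule less.prems(5))
  obtain F where "is_leaf ?D F" using less.prems(2,6) by blast
  then have F: "F \<in> S"
    and leaf: "S = {F} \<or> (\<exists>G\<in>S. G \<noteq> F \<and> (\<forall>H\<in>S. H \<noteq> F \<longrightarrow> F \<inter> H \<subseteq> G))"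
    unfolding is_leaf_def fac by auto
  from leaf show ?case
  proof
    \<comment> \<open>The complex is a full simplex: any vertex \<open>a\<close> dominates all
      others, and deleting them leaves a point.\<close>
    assume S: "S = {F}"
    obtain a where a: "a \<in> F" using less.prems(4) F by blast
    have "{B\<in>?D. B \<inter> (F - {a}) = {}} = {{}, {a}}"
      using a S unfolding generated_complex_def by auto
    then have "strong_collapsible {B\<in>?D. B \<inter> (F - {a}) = {}}"
      by (simp add: strong_collapsible.point)
    moreover have "dominated ?D w a" if "w \<in> F - {a}" for w
      using that a S unfolding dominated_def generated_complex_def by auto
    ultimately show ?case
      using strong_collapsible_delete_set[OF _ fc, of "F - {a}" a] less.prems(3)[OF F] by blast
  next
    assume "\<exists>G\<in>S. G \<noteq> F \<and> (\<forall>H\<in>S. H \<noteq> F \<longrightarrow> F \<inter> H \<subseteq> G)"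
    then obtain G where G: "G \<in> S" "G \<noteq> F"
      and joint: "\<And>H. H \<in> S \<Longrightarrow> H \<noteq> F \<Longrightarrow> F \<inter> H \<subseteq> G" by blast
    let ?T = "S - {F}"
    have "(F, G) \<in> (meets S)\<^sup>*" using less.prems(7) F G by blast
    \<comment> \<open>A chain from \<open>F\<close> to \<open>G\<close> must leave \<open>F\<close>,
      and the facet it moves to meets \<open>F\<close>. As this intersection lies in
      \<open>G\<close>, the leaf and its joint share a vertex \<open>a\<close>.\<close>
    then obtain H where "H \<in> S" "H \<noteq> F" "F \<inter> H \<noteq> {}"
    proof -
      have "\<exists>H\<in>S. H \<noteq> F \<and> F \<inter> H \<noteq> {}" if "(A, G) \<in> (meets S)\<^sup>*" "A = F" for A
        using that by (induction rule: converse_rtrancl_induct) (use G in auto)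
      then show ?thesis using \<open>(F, G) \<in> (meets S)\<^sup>*\<close> that by blast
    qed
    then obtain a where a: "a \<in> F" "a \<in> G" using joint by blast
    \<comment> \<open>What is left of \<open>F\<close> lies in \<open>G\<close>, and no other facet
      loses a vertex.\<close>
    have "{B\<in>?D. B \<inter> (F - G) = {}} = generated_complex ?T"
    proof (intro equalityI subsetI)
      fix B assume "B \<in> {B\<in>?D. B \<inter> (F - G) = {}}"
      then obtain K where K: "K \<in> S" "B \<subseteq> K" and BG: "B \<inter> (F - G) = {}"
        unfolding generated_complex_def by blast
      then have "B \<subseteq> (if K = F then G else K)" by auto
      then show "B \<in> generated_complex ?T"
        using K G unfolding generated_complex_def by (auto split: if_splits)
    next
      fix B assume "B \<in> generated_complex ?T"
      then obtain K where K: "K \<in> S" "K \<noteq> F" "B \<subseteq> K"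
        unfolding generated_complex_def by blast
      then show "B \<in> {B\<in>?D. B \<inter> (F - G) = {}}"
        using joint[of K] unfolding generated_complex_def by blast
    qed
    moreover have "strong_collapsible (generated_complex ?T)"
    proof (rule less.hyps)
      show "card ?T < card S" by (rule card_Diff1_less[OF less.prems(1) F])
      show "?T \<noteq> {}" using G by blast
      show "\<exists>K. is_leaf (generated_complex R) K" if "R \<subseteq> ?T" "R \<noteq> {}" for R
        using less.prems(6)[of R] that by blast
      show "(A, B) \<in> (meets ?T)\<^sup>*" if "A \<in> ?T" "B \<in> ?T" for A B
      proof -
        have "(A, B) \<in> (meets S)\<^sup>*" using less.prems(7) that by blast
        from connected_remove_leaf[OF this that(1) G joint] show ?thesis using that(2) by simp
      qed
    qed (use less.prems in auto)
    moreover have "dominated ?D w a" if w: "w \<in> F - G" for w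
      unfolding dominated_def
    proof (intro conjI ballI impI)
      show "a \<noteq> w" using w a by blast
      fix B assume "B \<in> ?D" "w \<in> B"
      then obtain K where K: "K \<in> S" "B \<subseteq> K" unfolding generated_complex_def by blast
      then have "K = F" using joint[of K] w \<open>w \<in> B\<close> by blast
      then show "insert a B \<in> ?D" using K a unfolding generated_complex_def by blast
    qed
    ultimately show ?case
      using strong_collapsible_delete_set[OF _ fc, of "F - G" a] less.prems(3)[OF F] by simp
  qed
qed

lemma simplicial_tree_strong_collapsible:
  assumes "simplicial_tree V \<Delta>"
  shows "strong_collapsible \<Delta>"
proof -
  have cx: "complex_on V \<Delta>" and conn: "connected_complex \<Delta>"
    and leaf: "\<And>T. T \<subseteq> facets \<Delta> \<Longrightarrow> T \<noteq> {} \<Longrightarrow> \<exists>F. is_leaf (generated_complex T) F"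
    using assms unfolding simplicial_tree_def by auto
  have "\<Union>\<Delta> \<subseteq> V" using cx unfolding complex_on_def by blast
  then have "finite (\<Union>\<Delta>)" using cx finite_subset[of _ V] by (simp add: complex_on_def)
  then have fc: "finite_complex \<Delta>" using cx by (simp add: complex_on_def finite_complex_def)
  obtain v where v: "v \<in> V" "{v} \<in> \<Delta>" using cx unfolding complex_on_def by blast
  have "strong_collapsible (generated_complex (facets \<Delta>))"
  proof (rule tree_strong_collapsible)
    show "finite (facets \<Delta>)" using finite_complex_finite[OF fc] unfolding facets_def by simp
    show "facets \<Delta> \<noteq> {}" using ex_facet[OF fc v(2)] by blast
    \<comment> \<open>The face \<open>{v}\<close> properly contains the empty face, which is
      therefore not maximal.\<close>
    show "F \<noteq> {}" if "F \<in> facets \<Delta>" for F using that v unfolding facets_def by auto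
    show "finite F" if "F \<in> facets \<Delta>" for F
      using that finite_complex_finite_face[OF fc] unfolding facets_def by auto
  qed (use leaf conn in \<open>auto simp: facets_def connected_complex_def\<close>)
  then show ?thesis using generated_facets[OF fc] by simp
qed

section \<open>Collapses\<close>

text \<open>The faces through \<open>v\<close> are matched in pairs \<open>B\<close>,
  \<open>insert a B\<close> with \<open>a\<close> not in \<open>B\<close>. Collapsing a pair with
  \<open>B\<close> maximal keeps \<open>v\<close> dominated, so induction on the number of faces
  applies.\<close>

lemma dominated_deletion_collapse:
  assumes "finite_complex \<Delta>" "dominated \<Delta> v a"
  shows "elementary_collapse\<^sup>*\<^sup>* \<Delta> {B\<in>\<Delta>. v \<notin> B}"
  using assms
proof (induction "card \<Delta>" arbitrary: \<Delta> rule: less_induct)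
  case less
  note down = finite_complex_down[OF less.prems(1)]
  have av: "a \<noteq> v" and ins: "\<And>B. B \<in> \<Delta> \<Longrightarrow> v \<in> B \<Longrightarrow> insert a B \<in> \<Delta>"
    using less.prems(2) unfolding dominated_def by auto
  have fin: "finite \<Delta>" by (rule finite_complex_finite[OF less.prems(1)])
  show ?case
  proof (cases "\<exists>C\<in>\<Delta>. v \<in> C")
    case False
    then have "{B\<in>\<Delta>. v \<notin> B} = \<Delta>" by auto
    then show ?thesis by simp
  next
    case True
    let ?P = "{B\<in>\<Delta>. v \<in> B \<and> a \<notin> B}"
    obtain C where "C \<in> \<Delta>" "v \<in> C" using True by blast
    then have "C - {a} \<in> ?P" using av down by auto
    then obtain B where B: "B \<in> ?P" and max: "\<And>C. C \<in> ?P \<Longrightarrow> B \<subseteq> C \<Longrightarrow> C = B"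
      using finite_has_maximal2[of ?P "C - {a}"] fin by auto
    let ?F = "insert a B"
    \<comment> \<open>Removing \<open>a\<close> from a face above \<open>B\<close> gives a member of
      \<open>?P\<close> above \<open>B\<close>, which is \<open>B\<close> by maximality. So
      \<open>?F\<close> is a facet and \<open>B\<close> a free face of it.\<close>
    have over: "H = B \<or> H = ?F" if "H \<in> \<Delta>" "B \<subseteq> H" for H
    proof -
      have "H - {a} \<in> ?P" using that B av down by auto
      then have "H - {a} = B" using max B that by blast
      then show ?thesis by blast
    qed
    have F: "?F \<in> \<Delta>" using ins B by blast
    have "finite B" using B finite_complex_finite_face[OF less.prems(1)] by blast
    have "?F \<in> facets \<Delta>" using F over unfolding facets_def by blast
    moreover have "H = ?F" if "H \<in> facets \<Delta>" "B \<subseteq> H" for H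
      using that over[of H] F unfolding facets_def by blast
    moreover have "B \<noteq> {}" "card ?F = card B + 1" using B \<open>finite B\<close> by auto
    ultimately have collapse: "elementary_collapse \<Delta> (\<Delta> - {?F, B})"
      unfolding elementary_collapse_def by blast
    let ?D = "\<Delta> - {?F, B}"
    have "\<Union>?D \<subseteq> \<Union>\<Delta>" by blast
    then have "finite (\<Union>?D)"
      using less.prems(1) unfolding finite_complex_def by (auto intro: finite_subset)
    \<comment> \<open>By \<open>over\<close>, the two removed faces are all the faces above
      \<open>B\<close>, so the rest is closed under subsets.\<close>
    then have "finite_complex ?D"
      using down over unfolding finite_complex_def by blast
    moreover have "dominated ?D v a"
      unfolding dominated_def
    proof (intro conjI ballI impI)
      fix C assume C: "C \<in> ?D" "v \<in> C"
      then have "\<not> B \<subseteq> C" using over[of C] by auto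
      then have "insert a C \<noteq> ?F" using B by auto
      moreover have "insert a C \<noteq> B" using B by auto
      ultimately show "insert a C \<in> ?D" using ins[of C] C by auto
    qed (rule av)
    moreover have "card ?D < card \<Delta>"
      using B fin by (intro psubset_card_mono) auto
    ultimately have "elementary_collapse\<^sup>*\<^sup>* ?D {B\<in>?D. v \<notin> B}"
      using less.hyps by blast
    moreover have "{B\<in>?D. v \<notin> B} = {B\<in>\<Delta>. v \<notin> B}" using B by auto
    ultimately show ?thesis
      using collapse by (simp add: converse_rtranclp_into_rtranclp)
  qed
qed

lemma strong_collapsible_collapsible:
  "strong_collapsible \<Delta> \<Longrightarrow> collapsible \<Delta>"
proof (induction rule: strong_collapsible.induct)
  case (point v)
  then show ?case unfolding collapsible_def by blast
next
  case (step \<Delta> v a)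
  then show ?case
    using dominated_deletion_collapse[of \<Delta> v a] unfolding collapsible_def
    by (meson rtranclp_trans)
qed

section \<open>Contractibility\<close>

text \<open>The free choice of \<open>W\<close> lets a complex and its deletion use the same index
  set for the sum of the coordinates.\<close>

lemma topspace_geometric_realization:
  assumes "finite W" "\<Union>\<Delta> \<subseteq> W"
  shows "topspace (geometric_realization \<Delta>) =
    {x. (\<forall>v. 0 \<le> x v) \<and> {v. x v \<noteq> 0} \<in> \<Delta> \<and> (\<Sum>v\<in>W. x v) = 1}"
proof -
  have "(\<Sum>v\<in>\<Union>\<Delta>. x v) = (\<Sum>v\<in>W. x v)" if "{v. x v \<noteq> 0} \<in> \<Delta>" for x :: "'a \<Rightarrow> real"
    by (rule sum.mono_neutral_left) (use assms that in auto)
  then show ?thesis unfolding geometric_realization_def by auto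
qed

lemma continuous_map_geometric_realization:
  assumes "\<And>v. continuous_map X euclideanreal (\<lambda>y. f y v)"
    and "f ` topspace X \<subseteq> topspace (geometric_realization \<Delta>)"
  shows "continuous_map X (geometric_realization \<Delta>) f"
  using assms unfolding geometric_realization_def
  by (auto simp: continuous_map_in_subtopology continuous_map_componentwise_UNIV)

lemma continuous_map_geometric_realization_component:
  "continuous_map (geometric_realization \<Delta>) euclideanreal (\<lambda>x. x v)"
  unfolding geometric_realization_def
  by (intro continuous_map_from_subtopology continuous_map_product_projection) auto

text \<open>The parameter \<open>t\<close> is time: \<open>t = 0\<close> gives the identity, and for
  \<open>a \<noteq> v\<close> time \<open>t = 1\<close> empties the coordinate \<open>v\<close>.
  Points with \<open>x v = 0\<close> never move.\<close>

definition shift_weight :: "'a \<Rightarrow> 'a \<Rightarrow> real \<Rightarrow> ('a \<Rightarrow> real) \<Rightarrow> 'a \<Rightarrow> real" where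
  "shift_weight v a t x = (\<lambda>u. x u + (if u = a then t * x v else 0) - (if u = v then t * x v else 0))"

text \<open>If \<open>x v\<close> is nonzero, the support of \<open>x\<close> is a face through
  \<open>v\<close>. The shift enlarges it by at most \<open>a\<close>, and domination makes the
  enlarged set a face.\<close>

lemma shift_weight_in_realization:
  assumes fc: "finite_complex \<Delta>" and dom: "dominated \<Delta> v a"
    and x: "x \<in> topspace (geometric_realization \<Delta>)" and t: "0 \<le> t" "t \<le> 1"
  shows "shift_weight v a t x \<in> topspace (geometric_realization \<Delta>)"
proof -
  \<comment> \<open>Neither \<open>a\<close> nor \<open>v\<close> is assumed to be a vertex of
    \<Delta>, so both are added to the range of the sum.\<close>
  let ?W = "insert a (insert v (\<Union>\<Delta>))"
  let ?y = "shift_weight v a t x"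
  have W: "finite ?W" "\<Union>\<Delta> \<subseteq> ?W" using fc unfolding finite_complex_def by auto
  note top = topspace_geometric_realization[OF W]
  have x0: "\<And>u. 0 \<le> x u" and supp: "{u. x u \<noteq> 0} \<in> \<Delta>" and sum1: "(\<Sum>u\<in>?W. x u) = 1"
    using x unfolding top by auto
  have "t * x v \<le> x v" using t x0[of v] by (simp add: mult_left_le_one_le)
  then have "0 \<le> ?y u" for u
    using x0[of u] x0[of v] t unfolding shift_weight_def by auto
  moreover have "{u. ?y u \<noteq> 0} \<in> \<Delta>"
  proof (cases "x v = 0")
    case True
    then have "?y = x" unfolding shift_weight_def by auto
    then show ?thesis using supp by simp
  next
    case False
    then have "insert a {u. x u \<noteq> 0} \<in> \<Delta>" using dom supp unfolding dominated_def by auto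
    moreover have "{u. ?y u \<noteq> 0} \<subseteq> insert a {u. x u \<noteq> 0}"
      unfolding shift_weight_def using False by auto
    ultimately show ?thesis using finite_complex_down[OF fc] by blast
  qed
  moreover have "(\<Sum>u\<in>?W. ?y u) = 1"
    unfolding shift_weight_def sum_subtractf sum.distrib sum1
    using W(1) by (simp add: sum.delta)
  ultimately show ?thesis unfolding top by simp
qed

lemma topspace_realization_deletion:
  assumes "finite_complex \<Delta>"
  shows "topspace (geometric_realization {B\<in>\<Delta>. v \<notin> B}) =
    {x \<in> topspace (geometric_realization \<Delta>). x v = 0}"
proof -
  have "finite (\<Union>\<Delta>)" "\<Union>{B\<in>\<Delta>. v \<notin> B} \<subseteq> \<Union>\<Delta>" using assms unfolding finite_complex_def by auto
  then show ?thesis by (auto simp: topspace_geometric_realization[of "\<Union>\<Delta>"])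
qed

text \<open>The realization of the deletion is a deformation retract: the map at time 1 fixes it
  pointwise, and the shift joins the identity to that map inside \<open>?X\<close>.\<close>

lemma dominated_deletion_homotopy_equivalent:
  assumes fc: "finite_complex \<Delta>" and dom: "dominated \<Delta> v a"
  shows "geometric_realization \<Delta> homotopy_equivalent_space
    geometric_realization {B\<in>\<Delta>. v \<notin> B}"
proof -
  let ?X = "geometric_realization \<Delta>" and ?Y = "geometric_realization {B\<in>\<Delta>. v \<notin> B}"
  let ?r = "shift_weight v a 1"
  have av: "a \<noteq> v" using dom unfolding dominated_def by simp
  note topY = topspace_realization_deletion[OF fc, of v]
  note comp = continuous_map_geometric_realization_component
  have r: "continuous_map ?X ?Y ?r"
  proof (rule continuous_map_geometric_realization)
    show "continuous_map ?X euclideanreal (\<lambda>x. ?r x u)" for u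
      unfolding shift_weight_def
      by (cases "u = a"; cases "u = v") (simp_all, (intro continuous_intros comp)+)
    show "?r ` topspace ?X \<subseteq> topspace ?Y"
    proof (intro image_subsetI)
      fix x assume "x \<in> topspace ?X"
      then have "?r x \<in> topspace ?X" by (rule shift_weight_in_realization[OF fc dom]) simp_all
      moreover have "?r x v = 0" using av by (simp add: shift_weight_def)
      ultimately show "?r x \<in> topspace ?Y" unfolding topY by simp
    qed
  qed
  have i: "continuous_map ?Y ?X id"
    by (rule continuous_map_geometric_realization) (use comp topY in auto)
  have ri: "homotopic_with (\<lambda>x. True) ?Y ?Y (?r \<circ> id) id"
  proof (rule homotopic_with_equal)
    show "continuous_map ?Y ?Y (?r \<circ> id)" by (rule continuous_map_compose[OF i r])
    show "(?r \<circ> id) x = id x" if "x \<in> topspace ?Y" for x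
      using that unfolding topY by (auto simp: shift_weight_def)
  qed auto
  have "homotopic_with (\<lambda>x. True) ?X ?X id ?r"
    unfolding homotopic_with_def
  proof (intro exI conjI ballI allI)
    let ?I = "top_of_set {0..1::real}"
    let ?h = "\<lambda>z. shift_weight v a (fst z) (snd z)"
    have t: "continuous_map (prod_topology ?I ?X) euclideanreal fst"
      using continuous_map_fst continuous_map_into_fulltopology by blast
    have x: "continuous_map (prod_topology ?I ?X) euclideanreal (\<lambda>z. snd z u)" for u
      using continuous_map_compose[OF continuous_map_snd comp] by (simp add: o_def)
    show "continuous_map (prod_topology ?I ?X) ?X ?h"
    proof (rule continuous_map_geometric_realization)
      show "continuous_map (prod_topology ?I ?X) euclideanreal (\<lambda>z. ?h z u)" for u
        unfolding shift_weight_def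
        by (cases "u = a"; cases "u = v") (simp_all, (intro continuous_intros t x)+)
      show "?h ` topspace (prod_topology ?I ?X) \<subseteq> topspace ?X"
        using shift_weight_in_realization[OF fc dom] by auto
    qed
  qed (auto simp: shift_weight_def)
  then have "homotopic_with (\<lambda>x. True) ?X ?X (id \<circ> ?r) id"
    by (simp add: homotopic_with_symD)
  with r i ri show ?thesis unfolding homotopy_equivalent_space_def by blast
qed

lemma contractible_realization_point:
  "contractible_space (geometric_realization {{}, {v}})"
proof (rule contractible_space_subset_singleton)
  have "x = (\<lambda>u. if u = v then 1 else 0)"
    if "x \<in> topspace (geometric_realization {{}, {v}})" for x
  proof -
    have "x v = 1" "{u. x u \<noteq> 0} \<subseteq> {v}"
      using that by (auto simp: topspace_geometric_realization[of "{v}"])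
    then show ?thesis by fastforce
  qed
  then show "topspace (geometric_realization {{}, {v}}) \<subseteq> {\<lambda>u. if u = v then 1 else 0}"
    by blast
qed

lemma strong_collapsible_contractible:
  "strong_collapsible \<Delta> \<Longrightarrow> contractible_space (geometric_realization \<Delta>)"
proof (induction rule: strong_collapsible.induct)
  case (point v)
  show ?case by (rule contractible_realization_point)
next
  case (step \<Delta> v a)
  then show ?case
    using homotopy_equivalent_space_contractibility[OF
        dominated_deletion_homotopy_equivalent[OF step.hyps(1,2)]] by simp
qed

section \<open>Acyclicity\<close>

definition incidence :: "('a \<times> 'a) set \<Rightarrow> 'a set \<Rightarrow> 'a \<Rightarrow> 'k::field" where
  "incidence r F v = (-1) ^ card {u \<in> F. u \<noteq> v \<and> (u, v) \<in> r}"

text \<open>The boundary is indexed by the vertices that can be added to \<open>G\<close>. It refers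
  to an ambient vertex set only, so one operator serves a complex and all its deletions.\<close>

definition boundary_on :: "('a \<times> 'a) set \<Rightarrow> 'a set \<Rightarrow> ('a set \<Rightarrow> 'k::field) \<Rightarrow> 'a set \<Rightarrow> 'k" where
  "boundary_on r U c = (\<lambda>G. \<Sum>v\<in>U - G. incidence r (insert v G) v * c (insert v G))"

lemma incidence_square [simp]: "incidence r F v * incidence r F v = (1::'k::field)"
  unfolding incidence_def by (simp flip: power_add power2_eq_square add: power_mult[symmetric])

lemma incidence_square_left [simp]: "incidence r F v * (incidence r F v * x) = (x::'k::field)"
  by (simp flip: mult.assoc)

lemma incidence_insert:
  assumes "finite F" "w \<notin> F" "w \<noteq> v"
  shows "(incidence r (insert w F) v :: 'k::field) =
    (if (w, v) \<in> r then - incidence r F v else incidence r F v)"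
proof -
  have "{u \<in> insert w F. u \<noteq> v \<and> (u, v) \<in> r} =
    (if (w, v) \<in> r then insert w {u \<in> F. u \<noteq> v \<and> (u, v) \<in> r} else {u \<in> F. u \<noteq> v \<and> (u, v) \<in> r})"
    using assms by auto
  then show ?thesis using assms unfolding incidence_def by simp
qed

text \<open>For fixed \<open>v\<close>, the only \<open>F\<close> containing \<open>v\<close> with
  \<open>F - {v} = G\<close> is \<open>insert v G\<close>, and only if \<open>v\<close> is not in
  \<open>G\<close>. If \<open>insert v G\<close> is not a face, the chain vanishes there, so the
  term is harmless.\<close>

lemma simp_boundary_eq_boundary_on:
  assumes fc: "finite_complex \<Delta>" and U: "finite U" "\<Union>\<Delta> \<subseteq> U" and c: "c \<in> simp_chains \<Delta> p"
  shows "simp_boundary r \<Delta> c = boundary_on r U c"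
proof
  fix G
  have fin: "finite \<Delta>" by (rule finite_complex_finite[OF fc])
  let ?g = "\<lambda>v. incidence r (insert v G) v * c (insert v G)"
  \<comment> \<open>The inner sum is extended by zeros from \<open>F\<close> to \<open>U\<close>, so
    that the two sums can be exchanged.\<close>
  have "simp_boundary r \<Delta> c G =
    (\<Sum>F\<in>\<Delta>. \<Sum>v\<in>U. if v \<in> F \<and> G = F - {v} then incidence r F v * c F else 0)"
    unfolding simp_boundary_def incidence_def
  proof (rule sum.cong[OF refl])
    fix F assume "F \<in> \<Delta>"
    then have "U \<inter> F = F" using U by auto
    then show "(\<Sum>v\<in>F. if G = F - {v} then (-1) ^ card {u \<in> F. u \<noteq> v \<and> (u, v) \<in> r} * c F else 0) =
      (\<Sum>v\<in>U. if v \<in> F \<and> G = F - {v}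
        then (-1) ^ card {u \<in> F. u \<noteq> v \<and> (u, v) \<in> r} * c F else 0)"
      by (subst (1) \<open>U \<inter> F = F\<close>[symmetric], subst sum.inter_restrict[OF U(1)])
        (auto intro!: sum.cong)
  qed
  also have "\<dots> = (\<Sum>v\<in>U. \<Sum>F\<in>\<Delta>. if v \<in> F \<and> G = F - {v} then incidence r F v * c F else 0)"
    by (rule sum.swap)
  also have "\<dots> = (\<Sum>v\<in>U. if v \<in> G then 0 else ?g v)"
  proof (rule sum.cong[OF refl])
    fix v
    have "(\<Sum>F\<in>\<Delta>. if v \<in> F \<and> G = F - {v} then incidence r F v * c F else 0) =
      (\<Sum>F\<in>\<Delta>. if F = insert v G then if v \<in> G then 0 else ?g v else 0)"
      by (intro sum.cong) auto
    also have "\<dots> = (if v \<in> G then 0 else ?g v)"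
      using fin c unfolding simp_chains_def by (auto simp: sum.delta)
    finally show "(\<Sum>F\<in>\<Delta>. if v \<in> F \<and> G = F - {v} then incidence r F v * c F else 0) =
      (if v \<in> G then 0 else ?g v)" .
  qed
  also have "\<dots> = (\<Sum>v\<in>U - G. ?g v)"
    using U(1) by (intro sum.mono_neutral_cong_right) auto
  finally show "simp_boundary r \<Delta> c G = boundary_on r U c G"
    unfolding boundary_on_def .
qed

lemma simp_chains_add:
  assumes "a \<in> simp_chains \<Delta> p" "b \<in> simp_chains \<Delta> p"
  shows "(\<lambda>F. a F + b F) \<in> simp_chains \<Delta> p"
  using assms unfolding simp_chains_def by simp (metis add.right_neutral)

lemma simp_chains_diff:
  assumes "a \<in> simp_chains \<Delta> p" "b \<in> simp_chains \<Delta> p"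
  shows "(\<lambda>F. a F - b F) \<in> simp_chains \<Delta> p"
  using assms unfolding simp_chains_def by simp metis

lemma boundary_on_add:
  "boundary_on r U (\<lambda>F. a F + b F) = (\<lambda>G. boundary_on r U a G + boundary_on r U b G)"
  unfolding boundary_on_def by (simp add: distrib_left sum.distrib)

lemma boundary_on_diff:
  "boundary_on r U (\<lambda>F. a F - b F) = (\<lambda>G. boundary_on r U a G - boundary_on r U b G)"
  unfolding boundary_on_def by (simp add: right_diff_distrib sum_subtractf)

text \<open>Adding two vertices to \<open>G\<close> in either order gives opposite signs, because
  the earlier vertex changes the sign of the later one but not conversely. Signs are defined by
  \<open>card\<close>, hence the finiteness condition.\<close>

lemma boundary_on_boundary_on:
  assumes U: "finite U" and fin: "\<And>F. c F \<noteq> 0 \<Longrightarrow> finite F"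
    and r: "\<And>u v. u \<in> U \<Longrightarrow> v \<in> U \<Longrightarrow> u \<noteq> v \<Longrightarrow> (u, v) \<in> r \<longleftrightarrow> (v, u) \<notin> r"
  shows "boundary_on r U (boundary_on r U c) = (\<lambda>_. 0 :: 'k::field)"
proof
  fix G
  let ?A = "U - G"
  define f where "f v w = (incidence r (insert v G) v *
    (incidence r (insert w (insert v G)) w * c (insert w (insert v G))) :: 'k)" for v w
  \<comment> \<open>Antisymmetry of \<open>f\<close> alone would only show that twice the sum is
    zero, which says nothing in characteristic 2. Keeping one order of each pair in \<open>g\<close>
    makes the terms cancel exactly.\<close>
  define g where "g v w = (if v \<noteq> w \<and> (v, w) \<in> r then f v w else 0)" for v w
  have anti: "f v w = - f w v" if "v \<in> ?A" "w \<in> ?A" "v \<noteq> w" "(v, w) \<in> r" for v w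
  proof (cases "c (insert w (insert v G)) = 0")
    case True
    then show ?thesis unfolding f_def by (simp add: insert_commute)
  next
    case False
    then have "finite G" using fin by (metis finite_insert)
    have "(w, v) \<notin> r" using r that by blast
    have 1: "(incidence r (insert w (insert v G)) w :: 'k) = - incidence r (insert w G) w"
      using incidence_insert[of "insert w G" v w r] \<open>finite G\<close> that by (auto simp: insert_commute)
    have 2: "(incidence r (insert v (insert w G)) v :: 'k) = incidence r (insert v G) v"
      using incidence_insert[of "insert v G" w v r] \<open>finite G\<close> that \<open>(w, v) \<notin> r\<close>
      by (auto simp: insert_commute)
    show ?thesis unfolding f_def 1 2 by (simp add: insert_commute)
  qed
  have "boundary_on r U (boundary_on r U c) G = (\<Sum>v\<in>?A. \<Sum>w\<in>U - insert v G. f v w)"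
    unfolding boundary_on_def f_def by (simp add: sum_distrib_left)
  also have "\<dots> = (\<Sum>v\<in>?A. \<Sum>w\<in>?A. g v w - g w v)"
  proof (rule sum.cong[OF refl])
    fix v assume v: "v \<in> ?A"
    have "(\<Sum>w\<in>U - insert v G. f v w) = (\<Sum>w\<in>?A. if w = v then 0 else f v w)"
      using U by (intro sum.mono_neutral_cong_left) auto
    also have "\<dots> = (\<Sum>w\<in>?A. g v w - g w v)"
    proof (rule sum.cong[OF refl])
      fix w assume w: "w \<in> ?A"
      show "(if w = v then 0 else f v w) = g v w - g w v"
        using r[of v w] anti[of w v] v w unfolding g_def by auto
    qed
    finally show "(\<Sum>w\<in>U - insert v G. f v w) = (\<Sum>w\<in>?A. g v w - g w v)" .
  qed
  also have "\<dots> = 0"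
    unfolding sum_subtractf using sum.swap[of g ?A ?A] by simp
  finally show "boundary_on r U (boundary_on r U c) G = 0" .
qed

lemma boundary_on_simp_chains:
  assumes fc: "finite_complex \<Delta>" and b: "b \<in> simp_chains \<Delta> (p + 1)"
  shows "boundary_on r U b \<in> simp_chains \<Delta> p"
  unfolding simp_chains_def
proof (intro CollectI allI impI)
  fix G assume "boundary_on r U b G \<noteq> 0"
  then obtain v where v: "v \<notin> G" "b (insert v G) \<noteq> 0"
    unfolding boundary_on_def
    by (metis (no_types, lifting) DiffD2 mult_zero_right sum.not_neutral_contains_not_neutral)
  then have "insert v G \<in> \<Delta>" "int (card (insert v G)) = p + 2"
    using b unfolding simp_chains_def by auto
  moreover from this have "finite G" using finite_complex_finite_face[OF fc] by fastforce
  ultimately show "G \<in> \<Delta> \<and> int (card G) = p + 1"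
    using v finite_complex_down[OF fc, of "insert v G" G] by auto
qed

text \<open>
  Taking \<open>Q B\<close> to mean \<open>v \<in> B\<close> treats the deletion of a dominated vertex; a constantly true \<open>Q\<close>
  treats cones with apex \<open>a\<close>, in particular a point.
\<close>

lemma homologous_off:
  fixes c :: "'a set \<Rightarrow> 'k::field"
  assumes fc: "finite_complex \<Delta>" and U: "finite U" "\<Union>\<Delta> \<subseteq> U"
    and r: "\<And>u v. u \<in> U \<Longrightarrow> v \<in> U \<Longrightarrow> u \<noteq> v \<Longrightarrow> (u, v) \<in> r \<longleftrightarrow> (v, u) \<notin> r"
    and c: "c \<in> simp_chains \<Delta> p" "boundary_on r U c = (\<lambda>_. 0)"
    and Q_insert: "\<And>B u. Q B \<Longrightarrow> Q (insert u B)" and Q_a: "\<And>B. Q (insert a B) \<Longrightarrow> Q B"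
    and cone: "\<And>B. B \<in> \<Delta> \<Longrightarrow> Q B \<Longrightarrow> insert a B \<in> \<Delta>"
  obtains b where "b \<in> simp_chains \<Delta> (p + 1)"
    and "\<And>B. Q B \<Longrightarrow> c B = boundary_on r U b B"
proof -
  \<comment> \<open>This is the cone with apex \<open>a\<close> over the part of \<open>c\<close> on
    faces with \<open>Q\<close> that avoid \<open>a\<close>. The sign is chosen so that it squares
    away in the boundary of \<open>b\<close>.\<close>
  define b where
    "b B = (if Q B \<and> a \<in> B then incidence r B a * c (B - {a}) else 0)" for B
  have a_U: "a \<in> U" if "B \<in> \<Delta>" "Q B" for B using cone[OF that] U by blast
  have b: "b \<in> simp_chains \<Delta> (p + 1)"
    unfolding simp_chains_def
  proof (intro CollectI allI impI)
    fix B assume "b B \<noteq> 0"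
    then have B: "Q B" "a \<in> B" "c (B - {a}) \<noteq> 0"
      unfolding b_def by (auto split: if_splits)
    then have "B - {a} \<in> \<Delta>" "int (card (B - {a})) = p + 1"
      using c(1) unfolding simp_chains_def by auto
    moreover have "Q (B - {a})" using Q_a[of "B - {a}"] B by (simp add: insert_absorb)
    ultimately have "B \<in> \<Delta>" using cone[of "B - {a}"] B by (simp add: insert_absorb)
    moreover have "card B = Suc (card (B - {a}))"
      using B(2) finite_complex_finite_face[OF fc \<open>B \<in> \<Delta>\<close>] by (metis card_Suc_Diff1)
    ultimately show "B \<in> \<Delta> \<and> int (card B) = p + 1 + 1"
      using \<open>int (card (B - {a})) = p + 1\<close> by simp
  qed
  define d where "d B = c B - boundary_on r U b B" for B
  have d_chain: "d \<in> simp_chains \<Delta> p"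
    unfolding d_def by (rule simp_chains_diff[OF c(1) boundary_on_simp_chains[OF fc b]])
  have "boundary_on r U (boundary_on r U b) = (\<lambda>_. 0)"
    by (rule boundary_on_boundary_on[OF U(1) _ r])
      (use b finite_complex_finite_face[OF fc] in \<open>auto simp: simp_chains_def\<close>)
  then have d_cycle: "boundary_on r U d = (\<lambda>_. 0)"
    unfolding d_def boundary_on_diff c(2) by simp
  \<comment> \<open>As \<open>b\<close> lives on faces containing \<open>a\<close>, only the term
    \<open>v = a\<close> of its boundary at \<open>B\<close> survives, and it equals
    \<open>c B\<close>.\<close>
  have d0: "d B = 0" if "Q B" "a \<notin> B" for B
  proof (cases "B \<in> \<Delta>")
    case False
    then show ?thesis using d_chain unfolding simp_chains_def by auto
  next
    case True
    have "boundary_on r U b B = (\<Sum>v\<in>{a}. incidence r (insert v B) v * b (insert v B))"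
      unfolding boundary_on_def
      by (rule sum.mono_neutral_right) (use U a_U[OF True that(1)] that(2) in \<open>auto simp: b_def\<close>)
    also have "\<dots> = c B" using that Q_insert by (simp add: b_def)
    finally show ?thesis unfolding d_def by simp
  qed
  have "d B = 0" if "Q B" for B
  proof (cases "a \<in> B")
    case False
    then show ?thesis using d0 that by blast
  next
    case True
    let ?B = "B - {a}"
    have QB: "Q ?B" using Q_a[of ?B] True that by (simp add: insert_absorb)
    show ?thesis
    proof (rule ccontr)
      assume "d B \<noteq> 0"
      then have "B \<in> \<Delta>" using d_chain unfolding simp_chains_def by auto
      \<comment> \<open>The cycle condition is evaluated at \<open>B - {a}\<close>: by
        \<open>d0\<close> all terms but the one for \<open>a\<close> vanish, and that one is
        \<open>d B\<close> up to sign.\<close>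
      have "boundary_on r U d ?B = (\<Sum>v\<in>{a}. incidence r (insert v ?B) v * d (insert v ?B))"
        unfolding boundary_on_def
      proof (rule sum.mono_neutral_right)
        show "\<forall>v\<in>U - ?B - {a}. incidence r (insert v ?B) v * d (insert v ?B) = 0"
          using d0[OF Q_insert[OF QB]] by auto
      qed (use U a_U[OF \<open>B \<in> \<Delta>\<close> that] in auto)
      also have "\<dots> = incidence r B a * d B" using True by (simp add: insert_absorb)
      finally have "incidence r B a * d B = 0" using d_cycle by simp
      then show False
        using \<open>d B \<noteq> 0\<close> incidence_square_left[of r B a "d B"] by (metis mult_zero_right)
    qed
  qed
  then show ?thesis using that[OF b] unfolding d_def by simp
qed

text \<open>Subtracting a boundary moves a cycle into the deletion, where it bounds by induction.
  Keeping \<open>U\<close> fixed keeps the boundary operator the same throughout.\<close>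

lemma strong_collapsible_exact:
  fixes c :: "'a set \<Rightarrow> 'k::field"
  assumes "strong_collapsible \<Delta>" and U: "finite U" "\<Union>\<Delta> \<subseteq> U"
    and r: "\<And>u v. u \<in> U \<Longrightarrow> v \<in> U \<Longrightarrow> u \<noteq> v \<Longrightarrow> (u, v) \<in> r \<longleftrightarrow> (v, u) \<notin> r"
    and c: "c \<in> simp_chains \<Delta> p" "boundary_on r U c = (\<lambda>_. 0)"
  shows "\<exists>b \<in> simp_chains \<Delta> (p + 1). boundary_on r U b = c"
  using assms(1) U(2) c
proof (induction arbitrary: c rule: strong_collapsible.induct)
  case (point v)
  have "finite_complex {{}, {v}}"
    by (rule strong_collapsible_finite_complex[OF strong_collapsible.point])
  \<comment> \<open>The point is a cone with apex \<open>v\<close>, so \<open>c\<close> bounds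
    everywhere. Degree -1 is included: the empty face is the boundary of \<open>{v}\<close>.\<close>
  from homologous_off[OF this U(1) point.prems(1) r point.prems(2,3), of "\<lambda>_. True" v]
  obtain b where "b \<in> simp_chains {{}, {v}} (p + 1)" "\<And>B. c B = boundary_on r U b B"
    by auto
  then show ?case by (intro bexI[of _ b]) auto
next
  case (step \<Delta> v a)
  let ?D = "{B\<in>\<Delta>. v \<notin> B}"
  have av: "a \<noteq> v" and ins: "\<And>B. B \<in> \<Delta> \<Longrightarrow> v \<in> B \<Longrightarrow> insert a B \<in> \<Delta>"
    using step.hyps(2) unfolding dominated_def by auto
  from homologous_off[OF step.hyps(1) U(1) step.prems(1) r step.prems(2,3), of "\<lambda>B. v \<in> B" a]
  obtain b where b: "b \<in> simp_chains \<Delta> (p + 1)" and cb: "\<And>B. v \<in> B \<Longrightarrow> c B = boundary_on r U b B"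
    using av ins by auto
  let ?d = "\<lambda>B. c B - boundary_on r U b B"
  \<comment> \<open>By \<open>cb\<close> the difference vanishes on all faces through
    \<open>v\<close>.\<close>
  have "?d \<in> simp_chains ?D p"
    using simp_chains_diff[OF step.prems(2) boundary_on_simp_chains[OF step.hyps(1) b, of r U]] cb
    unfolding simp_chains_def by auto
  moreover have "boundary_on r U (boundary_on r U b) = (\<lambda>_. 0)"
    by (rule boundary_on_boundary_on[OF U(1) _ r])
      (use b finite_complex_finite_face[OF step.hyps(1)] in \<open>auto simp: simp_chains_def\<close>)
  then have "boundary_on r U ?d = (\<lambda>_. 0)"
    unfolding boundary_on_diff step.prems(3) by simp
  moreover have "\<Union>?D \<subseteq> U" using step.prems(1) by blast
  ultimately obtain e where e: "e \<in> simp_chains ?D (p + 1)" "boundary_on r U e = ?d"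
    using step.IH by blast
  have "(\<lambda>F. b F + e F) \<in> simp_chains \<Delta> (p + 1)"
    by (rule simp_chains_add[OF b]) (use e(1) in \<open>auto simp: simp_chains_def\<close>)
  moreover have "boundary_on r U (\<lambda>F. b F + e F) = c"
    unfolding boundary_on_add e(2) by simp
  ultimately show ?case by blast
qed

section \<open>From exactness to the trivial homology group\<close>

lemma trivial_factor_by_carrier:
  assumes "group G"
  shows "trivial_group (G Mod carrier G)"
proof -
  interpret group G by fact
  have "group (G Mod carrier G)" by (rule normal.factorgroup_is_group[OF normal_self])
  moreover have "carrier (G Mod carrier G) = {carrier G}"
    using coset_join2[OF _ subgroup_self] one_closed unfolding FactGroup_def RCOSETS_def by auto
  ultimately show ?thesis unfolding trivial_group_def by simp
qed

lemma comm_group_simp_cycle_group: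
  "comm_group (simp_cycle_group r \<Delta> p :: ('a set \<Rightarrow> 'k::field) monoid)"
proof (rule comm_groupI)
  let ?G = "simp_cycle_group r \<Delta> p :: ('a set \<Rightarrow> 'k) monoid"
  have add: "simp_boundary r \<Delta> (\<lambda>F. a F + b F) = (\<lambda>G. simp_boundary r \<Delta> a G + simp_boundary r \<Delta> b G)"
    for a b :: "'a set \<Rightarrow> 'k"
    unfolding simp_boundary_def
    by (auto simp: sum.distrib[symmetric] distrib_left intro!: ext sum.cong)
  have zero: "simp_boundary r \<Delta> (\<lambda>_. 0::'k) = (\<lambda>_. 0)"
    unfolding simp_boundary_def by (simp cong: if_cong)
  show "x \<otimes>\<^bsub>?G\<^esub> y \<in> carrier ?G" if "x \<in> carrier ?G" "y \<in> carrier ?G" for x y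
    using that unfolding simp_cycle_group_def by (simp add: add simp_chains_add)
  show "\<one>\<^bsub>?G\<^esub> \<in> carrier ?G"
    unfolding simp_cycle_group_def simp_chains_def by (simp add: zero)
  show "\<exists>y\<in>carrier ?G. y \<otimes>\<^bsub>?G\<^esub> x = \<one>\<^bsub>?G\<^esub>" if x: "x \<in> carrier ?G" for x
  proof (rule bexI)
    \<comment> \<open>That the negative of a cycle is a cycle follows from additivity applied to
      \<open>x\<close> and its negative.\<close>
    have "simp_boundary r \<Delta> (\<lambda>F. x F + - x F) = (\<lambda>_. 0)" by (simp add: zero)
    then have "simp_boundary r \<Delta> (\<lambda>F. - x F) = (\<lambda>_. 0)"
      using x unfolding add simp_cycle_group_def by simp
    then show "(\<lambda>F. - x F) \<in> carrier ?G"
      using x unfolding simp_cycle_group_def simp_chains_def by auto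
    show "(\<lambda>F. - x F) \<otimes>\<^bsub>?G\<^esub> x = \<one>\<^bsub>?G\<^esub>"
      unfolding simp_cycle_group_def by simp
  qed
qed (auto simp: simp_cycle_group_def add_ac)

lemma strong_collapsible_acyclic:
  assumes "strong_collapsible \<Delta>"
  shows "acyclic_complex TYPE('k::field) \<Delta>"
  unfolding acyclic_complex_def
proof (intro allI impI)
  fix r p
  assume lin: "linear_order_on (\<Union>\<Delta>) r"
  let ?U = "\<Union>\<Delta>"
  let ?G = "simp_cycle_group r \<Delta> p :: ('a set \<Rightarrow> 'k) monoid"
  have fc: "finite_complex \<Delta>" by (rule strong_collapsible_finite_complex[OF assms])
  then have U: "finite ?U" unfolding finite_complex_def by simp
  have r: "(u, v) \<in> r \<longleftrightarrow> (v, u) \<notin> r" if "u \<in> ?U" "v \<in> ?U" "u \<noteq> v" for u v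
    using lin that unfolding order_on_defs total_on_def antisym_def by blast
  note eq = simp_boundary_eq_boundary_on[OF fc U order_refl, of _ _ r]
  \<comment> \<open>One inclusion says that the boundary squares to zero, the other is
    exactness.\<close>
  have "simp_boundary r \<Delta> ` simp_chains \<Delta> (p + 1) = carrier ?G"
  proof (intro equalityI subsetI)
    fix c :: "'a set \<Rightarrow> 'k" assume "c \<in> simp_boundary r \<Delta> ` simp_chains \<Delta> (p + 1)"
    then obtain b where b: "b \<in> simp_chains \<Delta> (p + 1)" and c: "c = boundary_on r ?U b"
      using eq by auto
    have "c \<in> simp_chains \<Delta> p" unfolding c by (rule boundary_on_simp_chains[OF fc b])
    moreover have "boundary_on r ?U c = (\<lambda>_. 0)"
      unfolding c by (rule boundary_on_boundary_on[OF U _ r])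
        (use b finite_complex_finite_face[OF fc] in \<open>auto simp: simp_chains_def\<close>)
    ultimately show "c \<in> carrier ?G" unfolding simp_cycle_group_def by (simp add: eq)
  next
    fix c :: "'a set \<Rightarrow> 'k" assume "c \<in> carrier ?G"
    then have c: "c \<in> simp_chains \<Delta> p" "boundary_on r ?U c = (\<lambda>_. 0)"
      unfolding simp_cycle_group_def by (auto simp: eq)
    obtain b where "b \<in> simp_chains \<Delta> (p + 1)" "boundary_on r ?U b = c"
      using strong_collapsible_exact[OF assms U order_refl r c] by blast
    then show "c \<in> simp_boundary r \<Delta> ` simp_chains \<Delta> (p + 1)" using eq by force
  qed
  then show "trivial_group (reduced_simp_homology r \<Delta> p :: ('a set \<Rightarrow> 'k) set monoid)"
    unfolding reduced_simp_homology_def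
    using trivial_factor_by_carrier[OF comm_group.axioms(2)[OF comm_group_simp_cycle_group]] by metis
qed

theorem theorem2p9:
  fixes V :: "'a set" and \<Delta> :: "'a set set"
  assumes "simplicial_tree V \<Delta>"
  shows "collapsible \<Delta> \<and>
         contractible_space (geometric_realization \<Delta>) \<and>
         acyclic_complex TYPE('k::field) \<Delta>"
  using simplicial_tree_strong_collapsible[OF assms] strong_collapsible_collapsible
    strong_collapsible_contractible strong_collapsible_acyclic by blast

end
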